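(* Let $p\ge 1$, let $u_1,\ldots,u_p,r_1,\ldots,r_p$ be positive integers, put $A_k=1+\sum_{i=1}^k u_i$ and $B_k=1+\sum_{i=1}^k r_i$ for $k\in[p]$, and let $\mathcal{P}=\mathcal{P}\begin{pmatrix} u_1 & u_2 & \cdots & u_p\\ r_1 & r_2 & \cdots & r_p\end{pmatrix}$ be the associated staircase polyomino. Let $e_1,\ldots,e_{A_p+B_p}$ be the canonical basis of $\mathbb{R}^{A_p+B_p}$ and let $$B=\{\log(x_iy_j) \mid (i,j)\in V(\mathcal{P})\}=\{e_i+e_{B_p+j}\mid (i,j)\in V(\mathcal{P})\}\subset\mathbb{N}^{B_p+A_p}$$ be the set of exponents of the generators of the toric ring $R=K[x_iy_j\mid (i,j)\in V(\mathcal{P})]$. Set $$\nu_i=-\sum_{k\in[B_i-1]}e_k+\sum_{k\in[A_i]}e_{B_p+k}\quad (i\in[p-1]),\qquad \nu=\sum_{k\in[B_p]}e_k-\sum_{k\in[A_p]}e_{B_p+k},$$ and $N=\{\nu_i,\ e_k\mid i\in[p-1],\ k\in[A_p+B_p]\}$. Then the cone generated by $B$ has the irredundant representation $$\mathbb{R}_+B=\Big(\bigcap_{a\in N}H_a^+\Big)\cap H_\nu ,$$ i.e. this equality holds and none of the half-spaces $H_a^+$, $a\in N$, can be omitted from the right-hand side.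
   Context: $\mathbb{N}$ is the set of nonnegative integers, and $[m]=\{1,\ldots,m\}$ (with $[0]=\emptyset$). For $0\ne a\in\mathbb{Q}^m$, $H_a=\{x\in\mathbb{R}^m\mid\langle x,a\rangle=0\}$ and $H_a^+=\{x\in\mathbb{R}^m\mid\langle x,a\rangle\ge0\}$, where $\langle\ ,\ \rangle$ is the standard scalar product. $\mathbb{R}_+B$ is the set of all finite linear combinations of elements of $B$ with nonnegative real coefficients. $\log$ of a monomial denotes its exponent vector, the variables being ordered $x_1,\ldots,x_{B_p},y_1,\ldots,y_{A_p}$. $K$ is a field. The polyomino $\mathcal{P}\begin{pmatrix} u_1 & \cdots & u_p\\ r_1 & \cdots & r_p\end{pmatrix}$ is the collection of unit cells with lower left corner $(1,1)$, all of whose columns of cells start at height $1$, whose first $r_1$ columns consist of $A_1-1$ cells, next $r_2$ columns consist of $A_2-1$ cells, and so on, the last $r_p$ columns consisting of $A_p-1$ cells. $V(\mathcal{P})$ is the set of all corners of cells of $\mathcal{P}$. Explicitly, $V(\mathcal{P})$ is the set of integer points $(i,j)$ with $1\le i\le B_p$ and $1\le j\le h(i)$, where $h(i)=A_1$ for $1\le i\le B_1-1$, $h(i)=A_s$ for $2\le s\le p$ and $B_{s-1}\le i\le B_s-1$, and $h(B_p)=A_p$. *)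

theory Defs
  imports Complex_Main "Jordan_Normal_Form.Matrix"
begin

text \<open>
  The parameters are sequences \<open>u, r :: nat \<Rightarrow> nat\<close>, of which only the entries with indices
  \<open>1, \<dots>, p\<close> matter. Both \<open>A\<^sub>k = level u k\<close> and \<open>B\<^sub>k = level r k\<close>; in addition \<open>level r 0 = 1\<close>,
  so that the first block of columns needs no separate treatment.
\<close>

definition level :: "(nat \<Rightarrow> nat) \<Rightarrow> nat \<Rightarrow> nat" where
  "level u k = 1 + (\<Sum>i\<in>{1..k}. u i)"

text \<open>A unit cell is represented by its lower left corner.\<close>

definition staircase :: "nat \<Rightarrow> (nat \<Rightarrow> nat) \<Rightarrow> (nat \<Rightarrow> nat) \<Rightarrow> (nat \<times> nat) set" where
  "staircase p u r =
     {(i, j). \<exists>k\<in>{1..p}. level r (k - 1) \<le> i \<and> i < level r k \<and> 1 \<le> j \<and> j \<le> level u k - 1}"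

definition vertices :: "(nat \<times> nat) set \<Rightarrow> (nat \<times> nat) set" where
  "vertices P = (\<Union>(i, j)\<in>P. {i, i + 1} \<times> {j, j + 1})"

lemma vertices_staircase:
  assumes "p \<ge> 1" and pos: "\<And>i. i \<in> {1..p} \<Longrightarrow> 0 < u i \<and> 0 < r i"
  shows "vertices (staircase p u r) =
    (\<Union>s\<in>{1..p}. {level r (s - 1)..level r s - 1} \<times> {1..level u s}) \<union>
    {level r p} \<times> {1..level u p}"
    (is "?L = ?R")
proof -
  have step: "level w s = level w (s - 1) + w s" if "s \<ge> 1" for w s
    using that unfolding level_def by (cases s) auto
  have A2: "level u s \<ge> 2" and B: "level r (s - 1) < level r s" if "s \<in> {1..p}" for s
    using step[of s u] step[of s r] pos[OF that] that by (auto simp: level_def)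
  have cell: "(i, j) \<in> staircase p u r"
    if "s \<in> {1..p}" "level r (s - 1) \<le> i" "i < level r s" "1 \<le> j" "j < level u s" for s i j
    using that unfolding staircase_def by auto
  show ?thesis
  proof (intro subset_antisym subsetI)
    fix v assume "v \<in> ?L"
    then obtain i j where ij: "(i, j) \<in> staircase p u r" "v \<in> {i, i + 1} \<times> {j, j + 1}"
      unfolding vertices_def by blast
    obtain k where k: "k \<in> {1..p}" "level r (k - 1) \<le> i" "i < level r k"
      "1 \<le> j" "j \<le> level u k - 1"
      using ij(1) unfolding staircase_def by blast
    obtain a b where v: "v = (a, b)" "a \<in> {i, i + 1}" "b \<in> {j, j + 1}"
      using ij(2) by blast
    have b: "1 \<le> b" "b \<le> level u k" using v k A2[OF k(1)] by auto
    consider "a < level r k" | "a = level r k" "k = p" | "a = level r k" "Suc k \<in> {1..p}"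
      using v k by fastforce
    then show "v \<in> ?R"
    proof cases
      case 1
      then show ?thesis using v k b by (intro UnI1 UN_I[OF k(1)]) auto
    next
      case 2
      then show ?thesis using v b by auto
    next
      case 3
      then show ?thesis using v b B[OF 3(2)] step[of "Suc k" u]
        by (intro UnI1 UN_I[OF 3(2)]) auto
    qed
  next
    fix v assume "v \<in> ?R"
    then obtain a b s i where v: "v = (a, b)" "1 \<le> b" "b \<le> level u s" and s: "s \<in> {1..p}"
      and i: "level r (s - 1) \<le> i" "i < level r s" "a \<in> {i, i + 1}"
    proof
      assume "v \<in> (\<Union>s\<in>{1..p}. {level r (s - 1)..level r s - 1} \<times> {1..level u s})"
      then obtain s a b where "s \<in> {1..p}" "v = (a, b)"
        "a \<in> {level r (s - 1)..level r s - 1}" "b \<in> {1..level u s}" by blast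
      then show thesis using B[of s] that[of a b s a] by auto
    next
      assume "v \<in> {level r p} \<times> {1..level u p}"
      then show thesis
        using B[of p] assms(1) that[of "level r p" "snd v" p "level r p - 1"] by auto
    qed
    let ?j = "if b = level u s then b - 1 else b"
    have "(i, ?j) \<in> staircase p u r"
      using cell[OF s i(1,2), of ?j] v A2[OF s] by auto
    moreover have "v \<in> {i, i + 1} \<times> {?j, ?j + 1}" using v i(3) A2[OF s] by auto
    ultimately show "v \<in> ?L" unfolding vertices_def by blast
  qed
qed

text \<open>
  \<open>\<real>\<^sup>m\<close> is \<open>carrier_vec m\<close>, whose coordinates are numbered from \<open>0\<close>. All formulas below number
  the coordinates from \<open>1\<close>; the shift occurs only in \<open>basis_vec\<close>.
\<close>

definition basis_vec :: "nat \<Rightarrow> nat \<Rightarrow> real vec" where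
  "basis_vec m k = unit_vec m (k - 1)"

definition hyperplane :: "nat \<Rightarrow> real vec \<Rightarrow> real vec set" where
  "hyperplane m a = {x \<in> carrier_vec m. x \<bullet> a = 0}"

definition halfspace :: "nat \<Rightarrow> real vec \<Rightarrow> real vec set" where
  "halfspace m a = {x \<in> carrier_vec m. x \<bullet> a \<ge> 0}"

definition cone_of :: "nat \<Rightarrow> real vec set \<Rightarrow> real vec set" where
  "cone_of m G = {finsum_vec TYPE(real) m (\<lambda>v. c v \<cdot>\<^sub>v v) S | S c.
     finite S \<and> S \<subseteq> G \<and> (\<forall>v\<in>S. 0 \<le> c v)}"

definition ambient_dim :: "nat \<Rightarrow> (nat \<Rightarrow> nat) \<Rightarrow> (nat \<Rightarrow> nat) \<Rightarrow> nat" where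
  "ambient_dim p u r = level u p + level r p"

text \<open>The exponent vectors of the monomials \<open>x\<^sub>i y\<^sub>j\<close>, the \<open>x\<close>-variables coming first.\<close>

definition generator_exponents :: "nat \<Rightarrow> (nat \<Rightarrow> nat) \<Rightarrow> (nat \<Rightarrow> nat) \<Rightarrow> real vec set" where
  "generator_exponents p u r =
     {basis_vec (ambient_dim p u r) i + basis_vec (ambient_dim p u r) (level r p + j) | i j.
        (i, j) \<in> vertices (staircase p u r)}"

definition nu_i :: "nat \<Rightarrow> (nat \<Rightarrow> nat) \<Rightarrow> (nat \<Rightarrow> nat) \<Rightarrow> nat \<Rightarrow> real vec" where
  "nu_i p u r i =
     - finsum_vec TYPE(real) (ambient_dim p u r)
         (\<lambda>k. basis_vec (ambient_dim p u r) k) {1..level r i - 1}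
     + finsum_vec TYPE(real) (ambient_dim p u r)
         (\<lambda>k. basis_vec (ambient_dim p u r) (level r p + k)) {1..level u i}"

definition nu :: "nat \<Rightarrow> (nat \<Rightarrow> nat) \<Rightarrow> (nat \<Rightarrow> nat) \<Rightarrow> real vec" where
  "nu p u r =
     finsum_vec TYPE(real) (ambient_dim p u r)
       (\<lambda>k. basis_vec (ambient_dim p u r) k) {1..level r p}
     - finsum_vec TYPE(real) (ambient_dim p u r)
         (\<lambda>k. basis_vec (ambient_dim p u r) (level r p + k)) {1..level u p}"

definition normals :: "nat \<Rightarrow> (nat \<Rightarrow> nat) \<Rightarrow> (nat \<Rightarrow> nat) \<Rightarrow> real vec set" where
  "normals p u r =
     {nu_i p u r i | i. i \<in> {1..p - 1}} \<union>
     {basis_vec (ambient_dim p u r) k | k. k \<in> {1..ambient_dim p u r}}"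

end

theory Submission
  imports Defs
begin

text \<open>
  A point of the right-hand side prescribes supplies \<open>x\<^sub>i\<close> and demands \<open>y\<^sub>j\<close> of equal total, and
  writing it as a nonnegative combination of the generators amounts to a transport plan supported
  on the vertices. The northwest corner rule gives one: lay the \<open>x\<^sub>i\<close> and the \<open>y\<^sub>j\<close> end to end on
  the same interval and ship from \<open>i\<close> to \<open>j\<close> the length of the overlap of their segments. The
  inequality of \<open>\<nu>\<^sub>s\<close> says precisely that the segments of the columns \<open>i < B\<^sub>s\<close> end before those of
  the rows \<open>j > A\<^sub>s\<close> begin, so nothing is shipped outside the vertices.

  For irredundancy, a sum or difference of two basis vectors violates one given inequality only:
  the exponent of \<open>x\<^sub>i y\<^sub>j\<close> with \<open>i = B\<^sub>s - 1\<close>, \<open>j = A\<^sub>s + 1\<close> for \<open>\<nu>\<^sub>s\<close>, and \<open>e\<^sub>l - e\<^sub>k\<close> for \<open>e\<^sub>k\<close>,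
  where \<open>k\<close> and \<open>l\<close> belong to the same group of variables and \<open>l\<close> is chosen such that shifting
  weight from \<open>k\<close> to \<open>l\<close> decreases no \<open>\<nu>\<^sub>s\<close>.
\<close>

section \<open>Transport plans\<close>

text \<open>For \<open>a \<le> b\<close> and \<open>c \<le> d\<close> this is the length of \<open>[a, b] \<inter> [c, d]\<close>, written as a difference so
  that it telescopes in the second interval.\<close>

definition overlap :: "real \<Rightarrow> real \<Rightarrow> real \<Rightarrow> real \<Rightarrow> real" where
  "overlap a b c d = min b (max a d) - min b (max a c)"

lemma overlap_nonneg: "c \<le> d \<Longrightarrow> 0 \<le> overlap a b c d"
  by (auto simp: overlap_def min_def max_def)

text \<open>Intersection is symmetric, but the defining formula is not. For ordered endpoints the
  symmetry lets sums over the first interval telescope like sums over the second.\<close>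

lemma overlap_commute: "a \<le> b \<Longrightarrow> c \<le> d \<Longrightarrow> overlap a b c d = overlap c d a b"
  by (auto simp: overlap_def min_def max_def)

lemma overlap_eq_0: "b \<le> c \<Longrightarrow> c \<le> d \<Longrightarrow> overlap a b c d = 0"
  by (auto simp: overlap_def min_def max_def)

lemma sum_overlap:
  "(\<Sum>j\<in>{1..q}. overlap a b (Y (j - 1)) (Y j)) = overlap a b (Y 0) (Y q)" for q :: nat
  by (induction q) (auto simp: overlap_def)

lemma sum_overlap_covering:
  fixes q :: nat
  assumes "Y 0 \<le> a" "a \<le> b" "b \<le> Y q"
  shows "(\<Sum>j\<in>{1..q}. overlap a b (Y (j - 1)) (Y j)) = b - a"
  unfolding sum_overlap using assms by (auto simp: overlap_def min_def max_def)

text \<open>Northwest corner rule for an arbitrary set \<open>V\<close> of admissible pairs: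
  \<open>C i j\<close> is the overlap of the \<open>i\<close>-th supply segment with the
  \<open>j\<close>-th demand segment. Outside \<open>V\<close>, the last hypothesis makes the supply
  segment end no later than the demand segment begins.\<close>

lemma transport_plan:
  fixes x y :: "nat \<Rightarrow> real"
  assumes x: "\<And>i. i \<in> {1..n} \<Longrightarrow> 0 \<le> x i" and y: "\<And>j. j \<in> {1..q} \<Longrightarrow> 0 \<le> y j"
    and total: "sum x {1..n} = sum y {1..q}"
    and V: "\<And>i j. i \<in> {1..n} \<Longrightarrow> j \<in> {1..q} \<Longrightarrow> (i, j) \<notin> V \<Longrightarrow> sum x {1..i} \<le> sum y {1..j - 1}"
  obtains C where
    "\<And>i j. i \<in> {1..n} \<Longrightarrow> j \<in> {1..q} \<Longrightarrow> 0 \<le> C i j"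
    "\<And>i j. i \<in> {1..n} \<Longrightarrow> j \<in> {1..q} \<Longrightarrow> (i, j) \<notin> V \<Longrightarrow> C i j = 0"
    "\<And>i. i \<in> {1..n} \<Longrightarrow> (\<Sum>j\<in>{1..q}. C i j) = x i"
    "\<And>j. j \<in> {1..q} \<Longrightarrow> (\<Sum>i\<in>{1..n}. C i j) = y j"
proof -
  define X Y where "X i = sum x {1..i}" and "Y j = sum y {1..j}" for i j :: nat
  let ?C = "\<lambda>i j. overlap (X (i - 1)) (X i) (Y (j - 1)) (Y j)"
  have mono: "sum f {1..i} \<le> sum f {1..j}"
    if "\<And>k. k \<in> {1..l} \<Longrightarrow> 0 \<le> f k" "i \<le> j" "j \<le> l" for f :: "nat \<Rightarrow> real" and i j l
    by (rule sum_mono2) (use that in auto)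
  have X: "X i \<le> X i'" if "i \<le> i'" "i' \<le> n" for i i'
    unfolding X_def by (rule mono[of n]) (use x that in auto)
  have Y: "Y j \<le> Y j'" if "j \<le> j'" "j' \<le> q" for j j'
    unfolding Y_def by (rule mono[of q]) (use y that in auto)
  have step: "f i = sum f {1..i} - sum f {1..i - 1}" if "1 \<le> i"
    for f :: "nat \<Rightarrow> real" and i
    using that by (cases i) auto
  have total': "X n = Y q" "X 0 = 0" "Y 0 = 0"
    using total by (auto simp: X_def Y_def)
  show thesis
  proof (rule that[of ?C])
    fix i j assume i: "i \<in> {1..n}" and j: "j \<in> {1..q}"
    show "0 \<le> ?C i j"
      using Y[of "j - 1" j] j by (intro overlap_nonneg) auto
    show "?C i j = 0" if "(i, j) \<notin> V"
      using V[OF i j that] Y[of "j - 1" j] j by (intro overlap_eq_0) (auto simp: X_def Y_def)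
  next
    fix i assume i: "i \<in> {1..n}"
    \<comment> \<open>Both subdivisions start at 0 and, by equality of the totals, end at the same
      point, so the demand segments cover each supply segment.\<close>
    have "(\<Sum>j\<in>{1..q}. ?C i j) = X i - X (i - 1)"
      by (rule sum_overlap_covering) (use X[of 0 "i - 1"] X[of "i - 1" i] X[of i n] total' i in auto)
    then show "(\<Sum>j\<in>{1..q}. ?C i j) = x i"
      using step[of i x] i by (simp add: X_def)
  next
    fix j assume j: "j \<in> {1..q}"
    have "(\<Sum>i\<in>{1..n}. ?C i j) = (\<Sum>i\<in>{1..n}. overlap (Y (j - 1)) (Y j) (X (i - 1)) (X i))"
      by (intro sum.cong refl overlap_commute X Y) (use j in auto)
    also have "\<dots> = Y j - Y (j - 1)"
      by (rule sum_overlap_covering) (use Y[of 0 "j - 1"] Y[of "j - 1" j] Y[of j q] total' j in auto)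
    finally show "(\<Sum>i\<in>{1..n}. ?C i j) = y j"
      using step[of j y] j by (simp add: Y_def)
  qed
qed

section \<open>Scalar products and cones\<close>

lemma scalar_prod_finsum_vec:
  fixes x :: "real vec"
  assumes "finite S" "f \<in> S \<rightarrow> carrier_vec m" "x \<in> carrier_vec m"
  shows "x \<bullet> finsum_vec TYPE(real) m f S = (\<Sum>v\<in>S. x \<bullet> f v)"
  using assms
proof (induction S rule: finite_induct)
  case empty
  then show ?case by (simp add: finsum_vec_empty)
next
  case (insert v S)
  then have "finsum_vec TYPE(real) m f S \<in> carrier_vec m"
    by (intro finsum_vec_closed) auto
  with insert show ?case
    by (simp add: finsum_vec_insert scalar_prod_add_distrib[where n = m])
qed

text \<open>Pairing with \<open>a\<close> is linear and the coefficients are nonnegative, so it is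
  enough to test the generators.\<close>

lemma cone_of_scalar_prod:
  assumes x: "x \<in> cone_of m G" and G: "G \<subseteq> carrier_vec m" and a: "a \<in> carrier_vec m"
  shows "x \<in> carrier_vec m"
    and "\<lbrakk>\<And>g. g \<in> G \<Longrightarrow> 0 \<le> g \<bullet> a\<rbrakk> \<Longrightarrow> 0 \<le> x \<bullet> a"
    and "\<lbrakk>\<And>g. g \<in> G \<Longrightarrow> g \<bullet> a = 0\<rbrakk> \<Longrightarrow> x \<bullet> a = 0"
proof -
  obtain S c where Sc: "finite S" "S \<subseteq> G" "\<forall>v\<in>S. 0 \<le> c v"
    and x: "x = finsum_vec TYPE(real) m (\<lambda>v. c v \<cdot>\<^sub>v v) S"
    using x unfolding cone_of_def by blast
  have closed: "(\<lambda>v. c v \<cdot>\<^sub>v v) \<in> S \<rightarrow> carrier_vec m"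
    using Sc G by auto
  show xm: "x \<in> carrier_vec m"
    unfolding x by (rule finsum_vec_closed[OF closed])
  have "x \<bullet> a = a \<bullet> x"
    using xm a by (rule comm_scalar_prod)
  also have "\<dots> = (\<Sum>v\<in>S. a \<bullet> (c v \<cdot>\<^sub>v v))"
    unfolding x by (rule scalar_prod_finsum_vec[OF Sc(1) closed a])
  also have "\<dots> = (\<Sum>v\<in>S. c v * (v \<bullet> a))"
  proof (rule sum.cong[OF refl])
    fix v assume "v \<in> S"
    then have v: "v \<in> carrier_vec m" using Sc G by auto
    then show "a \<bullet> (c v \<cdot>\<^sub>v v) = c v * (v \<bullet> a)"
      using a comm_scalar_prod[OF a, of "c v \<cdot>\<^sub>v v"] by simp
  qed
  finally have *: "x \<bullet> a = (\<Sum>v\<in>S. c v * (v \<bullet> a))" .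
  show "0 \<le> x \<bullet> a" if "\<And>g. g \<in> G \<Longrightarrow> 0 \<le> g \<bullet> a"
    unfolding * using Sc that by (auto intro!: sum_nonneg mult_nonneg_nonneg)
  show "x \<bullet> a = 0" if "\<And>g. g \<in> G \<Longrightarrow> g \<bullet> a = 0"
    unfolding * using Sc that by (auto intro!: sum.neutral)
qed

text \<open>In \<open>cone_of\<close> the coefficients are indexed by the vectors themselves,
  whereas a transport plan is indexed by pairs; injectivity of \<open>g\<close> carries the
  coefficients over.\<close>

lemma cone_ofI:
  assumes V: "finite V" "inj_on g V" "g ` V \<subseteq> G" "G \<subseteq> carrier_vec m"
    and C: "\<And>v. v \<in> V \<Longrightarrow> 0 \<le> C v"
    and x: "x \<in> carrier_vec m" "\<And>t. t < m \<Longrightarrow> x $ t = (\<Sum>v\<in>V. C v * g v $ t)"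
  shows "x \<in> cone_of m G"
proof -
  define c where "c w = C (inv_into V g w)" for w
  have c: "c (g v) = C v" if "v \<in> V" for v
    using V(2) that by (simp add: c_def)
  let ?f = "finsum_vec TYPE(real) m (\<lambda>w. c w \<cdot>\<^sub>v w) (g ` V)"
  have gm: "g v \<in> carrier_vec m" if "v \<in> V" for v
    using V(3,4) that by blast
  then have closed: "(\<lambda>w. c w \<cdot>\<^sub>v w) \<in> g ` V \<rightarrow> carrier_vec m"
    by auto
  have "x = ?f"
  proof (rule eq_vecI)
    show "dim_vec x = dim_vec ?f"
      using x(1) finsum_vec_closed[OF closed] by auto
  next
    fix t assume "t < dim_vec ?f"
    then have t: "t < m" using finsum_vec_closed[OF closed] by auto
    have "?f $ t = (\<Sum>w\<in>g ` V. (c w \<cdot>\<^sub>v w) $ t)"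
      by (rule index_finsum_vec) (use V(1) t gm in auto)
    also have "\<dots> = (\<Sum>v\<in>V. (c (g v) \<cdot>\<^sub>v g v) $ t)"
      by (simp add: sum.reindex[OF V(2)])
    also have "\<dots> = (\<Sum>v\<in>V. C v * g v $ t)"
    proof (rule sum.cong[OF refl])
      fix v assume v: "v \<in> V"
      show "(c (g v) \<cdot>\<^sub>v g v) $ t = C v * g v $ t"
        using t c[OF v] gm[OF v] by auto
    qed
    finally show "x $ t = ?f $ t" using x(2)[OF t] by simp
  qed
  moreover have "\<forall>w\<in>g ` V. 0 \<le> c w" using c C by auto
  ultimately show ?thesis unfolding cone_of_def using V by blast
qed

section \<open>Basis vectors and their sums\<close>

lemma basis_vec_carrier [simp]: "basis_vec m k \<in> carrier_vec m"
  by (simp add: basis_vec_def)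

lemma index_basis_vec:
  assumes "k \<in> {1..m}" "t < m"
  shows "basis_vec m k $ t = of_bool (k = Suc t)"
  using assms by (auto simp: basis_vec_def)

lemma scalar_prod_basis_vec:
  "k \<in> {1..m} \<Longrightarrow> x \<bullet> basis_vec m k = x $ (k - 1)"
  by (auto simp: basis_vec_def)

text \<open>The index map \<open>f\<close> serves both groups of variables: it is the identity for
  the \<open>x\<^sub>k\<close> and the shift by \<open>level r p\<close> for the
  \<open>y\<^sub>k\<close>.\<close>

lemma scalar_prod_sum_basis_vec:
  assumes "finite K" "f ` K \<subseteq> {1..m}" "x \<in> carrier_vec m"
  shows "x \<bullet> finsum_vec TYPE(real) m (\<lambda>k. basis_vec m (f k)) K = (\<Sum>k\<in>K. x $ (f k - 1))"
proof -
  have "x \<bullet> finsum_vec TYPE(real) m (\<lambda>k. basis_vec m (f k)) K = (\<Sum>k\<in>K. x \<bullet> basis_vec m (f k))"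
    by (rule scalar_prod_finsum_vec) (use assms in auto)
  also have "\<dots> = (\<Sum>k\<in>K. x $ (f k - 1))"
    by (intro sum.cong refl scalar_prod_basis_vec) (use assms(2) in blast)
  finally show ?thesis .
qed

lemma sum_index_basis_vec:
  assumes "finite K" "f ` K \<subseteq> {1..m}" "inj_on f K" "a \<in> {1..m}"
  shows "(\<Sum>k\<in>K. basis_vec m a $ (f k - 1)) = of_bool (a \<in> f ` K)"
proof -
  have "(\<Sum>k\<in>K. basis_vec m a $ (f k - 1)) = (\<Sum>k\<in>f ` K. basis_vec m a $ (k - 1))"
    by (simp add: sum.reindex[OF assms(3)])
  also have "\<dots> = (\<Sum>k\<in>f ` K. if a = k then 1 else 0)"
  proof (rule sum.cong[OF refl])
    fix k assume "k \<in> f ` K"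
    then have "k \<in> {1..m}" using assms(2) by blast
    then show "basis_vec m a $ (k - 1) = (if a = k then 1 else 0)"
      using assms(4) by (auto simp: index_basis_vec)
  qed
  also have "\<dots> = of_bool (a \<in> f ` K)" using assms(1) by simp
  finally show ?thesis .
qed

section \<open>The staircase\<close>

lemma level_pos: "1 \<le> level w k"
  by (simp add: level_def)

lemma level_0: "level w 0 = 1"
  by (simp add: level_def)

lemma level_mono: "s \<le> t \<Longrightarrow> level w s \<le> level w t"
  unfolding level_def by (intro add_left_mono sum_mono2) auto

lemma level_less:
  assumes "\<And>i. i \<in> {1..p} \<Longrightarrow> 0 < w i" "s < t" "t \<le> p"
  shows "level w s < level w t"
proof -
  have "level w s < level w (Suc s)"
    using assms(1)[of "Suc s"] assms(2,3) by (simp add: level_def)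
  also have "\<dots> \<le> level w t" by (rule level_mono) (use assms(2) in simp)
  finally show ?thesis .
qed

locale staircase_data =
  fixes p :: nat and u r :: "nat \<Rightarrow> nat"
  assumes p: "1 \<le> p" and pos: "\<And>i. i \<in> {1..p} \<Longrightarrow> 0 < u i \<and> 0 < r i"
begin

abbreviation "m \<equiv> ambient_dim p u r"
abbreviation "n \<equiv> level r p"
abbreviation "q \<equiv> level u p"
abbreviation "V \<equiv> vertices (staircase p u r)"
abbreviation "G \<equiv> generator_exponents p u r"
abbreviation "e \<equiv> basis_vec m"

lemma m: "m = n + q"
  by (simp add: ambient_dim_def)

lemma level_r_less: "s < t \<Longrightarrow> t \<le> p \<Longrightarrow> level r s < level r t"
  using level_less[of p r s t] pos by auto

lemma level_u_less: "s < t \<Longrightarrow> t \<le> p \<Longrightarrow> level u s < level u t"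
  using level_less[of p u s t] pos by auto

lemma level_le_last:
  assumes "s \<in> {1..p - 1}"
  shows "level r s \<le> n" "level u s \<le> q"
  using assms by (auto intro!: level_mono)

lemma vertices_eq:
  "V = (\<Union>s\<in>{1..p}. {level r (s - 1)..level r s - 1} \<times> {1..level u s}) \<union> {n} \<times> {1..q}"
  using p pos by (rule vertices_staircase)

text \<open>Heights increase from block to block, so the bound from the block of column
  \<open>i\<close> implies those from all later blocks; \<open>j \<le> q\<close> takes care of the
  last block and of column \<open>n\<close>. In this form a pair of the rectangle outside
  \<open>V\<close> supplies an index \<open>s\<close> whose \<open>\<nu>\<^sub>s\<close> forbids
  shipping along it.\<close>

lemma vertices_iff:
  "(i, j) \<in> V \<longleftrightarrow> i \<in> {1..n} \<and> j \<in> {1..q} \<and> (\<forall>s\<in>{1..p - 1}. i < level r s \<longrightarrow> j \<le> level u s)"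
    (is "_ \<longleftrightarrow> ?R")
proof
  assume "(i, j) \<in> V"
  then consider s where "s \<in> {1..p}" "level r (s - 1) \<le> i" "i \<le> level r s - 1" "1 \<le> j" "j \<le> level u s"
    | "i = n" "1 \<le> j" "j \<le> q"
    unfolding vertices_eq by auto
  then show ?R
  proof cases
    case (1 s)
    have i: "1 \<le> i" "i \<le> n" using 1 level_pos[of r "s - 1"] level_mono[of s p r] by auto
    have j: "j \<le> q" using 1 level_mono[of s p u] by auto
    have "j \<le> level u t" if "i < level r t" for t
    proof -
      have "s \<le> t"
      proof (rule ccontr)
        assume "\<not> s \<le> t"
        then have "level r t \<le> level r (s - 1)" by (intro level_mono) simp
        then show False using that 1(2) by linarith
      qed
      then show ?thesis using level_mono[of s t u] 1(5) by linarith
    qed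
    then show ?R using i j 1 by auto
  next
    case 2
    have "\<not> i < level r s" if "s \<in> {1..p - 1}" for s
      using 2 level_le_last[OF that] by auto
    then show ?R using 2 level_pos[of r p] by auto
  qed
next
  assume R: ?R
  show "(i, j) \<in> V"
  proof (cases "i = n")
    case True
    then show ?thesis using R unfolding vertices_eq by auto
  next
    case False
    \<comment> \<open>The block of column \<open>i\<close>; it is not 0 because
      \<open>level r 0 = 1\<close>.\<close>
    define s where "s = (LEAST s. i < level r s)"
    have ip: "i < level r p" using False R by auto
    have s: "i < level r s" unfolding s_def by (rule LeastI) (rule ip)
    have sp: "s \<le> p" unfolding s_def by (rule Least_le) (rule ip)
    have s1: "1 \<le> s" using s R by (cases s) (auto simp: level_0)
    have "\<not> i < level r (s - 1)" unfolding s_def by (rule not_less_Least) (use s1 s_def in simp)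
    moreover have "j \<le> level u s"
    proof (cases "s = p")
      case False
      then have "s \<in> {1..p - 1}" using s1 sp by auto
      then show ?thesis using R s by blast
    qed (use R in auto)
    ultimately have "(i, j) \<in> {level r (s - 1)..level r s - 1} \<times> {1..level u s}"
      using s R by auto
    then show ?thesis using s1 sp unfolding vertices_eq by fastforce
  qed
qed

lemma finite_V: "finite V"
  by (rule finite_subset[of _ "{1..n} \<times> {1..q}"]) (use vertices_iff in auto)

section \<open>Pairings with the normals\<close>

lemma ball_normals:
  "(\<forall>a\<in>normals p u r. P a) \<longleftrightarrow> (\<forall>s\<in>{1..p - 1}. P (nu_i p u r s)) \<and> (\<forall>k\<in>{1..m}. P (e k))"
  unfolding normals_def by blast

lemma sums_carrier:
  "finsum_vec TYPE(real) m e K \<in> carrier_vec m"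
  "finsum_vec TYPE(real) m (\<lambda>k. e (l + k)) K \<in> carrier_vec m"
  by (auto intro!: finsum_vec_closed)

lemma nu_i_carrier [simp]: "nu_i p u r s \<in> carrier_vec m"
  unfolding nu_i_def using sums_carrier by auto

lemma nu_carrier [simp]: "nu p u r \<in> carrier_vec m"
  unfolding nu_def using sums_carrier by auto

lemma normals_carrier: "normals p u r \<subseteq> carrier_vec m"
  using ball_normals[of "\<lambda>a. a \<in> carrier_vec m"] by auto

text \<open>With coordinates numbered from 0, \<open>x\<^sub>k\<close> sits at \<open>k - 1\<close>
  and \<open>y\<^sub>j\<close> at \<open>n + j - 1\<close>. The pairing thus compares the partial
  sums that occur in the transport problem.\<close>

lemma scalar_prod_nu_i:
  assumes x: "x \<in> carrier_vec m" and s: "s \<in> {1..p - 1}"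
  shows "x \<bullet> nu_i p u r s =
    (\<Sum>j\<in>{1..level u s}. x $ (n + j - 1)) - (\<Sum>k\<in>{1..level r s - 1}. x $ (k - 1))"
proof -
  note le = level_le_last[OF s]
  have "x \<bullet> finsum_vec TYPE(real) m e {1..level r s - 1} = (\<Sum>k\<in>{1..level r s - 1}. x $ (k - 1))"
    by (rule scalar_prod_sum_basis_vec) (use x le m in auto)
  moreover have "x \<bullet> finsum_vec TYPE(real) m (\<lambda>k. e (n + k)) {1..level u s} =
      (\<Sum>j\<in>{1..level u s}. x $ (n + j - 1))"
    by (rule scalar_prod_sum_basis_vec) (use x le m in auto)
  ultimately show ?thesis
    unfolding nu_i_def using x sums_carrier
    by (simp add: scalar_prod_add_distrib[where n = m] carrier_vecD[where n = m])
qed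

lemma scalar_prod_nu:
  assumes x: "x \<in> carrier_vec m"
  shows "x \<bullet> nu p u r = (\<Sum>k\<in>{1..n}. x $ (k - 1)) - (\<Sum>j\<in>{1..q}. x $ (n + j - 1))"
proof -
  have "x \<bullet> finsum_vec TYPE(real) m e {1..n} = (\<Sum>k\<in>{1..n}. x $ (k - 1))"
    by (rule scalar_prod_sum_basis_vec) (use x m in auto)
  moreover have "x \<bullet> finsum_vec TYPE(real) m (\<lambda>k. e (n + k)) {1..q} =
      (\<Sum>j\<in>{1..q}. x $ (n + j - 1))"
    by (rule scalar_prod_sum_basis_vec) (use x m in auto)
  ultimately show ?thesis
    unfolding nu_def using x sums_carrier
    by (simp add: scalar_prod_minus_distrib[where n = m])
qed

lemma image_add_interval: "(+) n ` {1..t} = {n + 1..n + t}"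
  by (simp add: image_add_atLeastAtMost)

text \<open>The entry of \<open>\<nu>\<^sub>s\<close> at position \<open>a\<close>; as a difference
  of indicators it reduces later sign checks to comparisons of indices.\<close>

lemma e_nu_i:
  assumes a: "a \<in> {1..m}" and s: "s \<in> {1..p - 1}"
  shows "e a \<bullet> nu_i p u r s = of_bool (n < a \<and> a \<le> n + level u s) - of_bool (a < level r s)"
proof -
  note le = level_le_last[OF s]
  have "(\<Sum>k\<in>{1..level r s - 1}. e a $ (k - 1)) = of_bool (a \<in> (\<lambda>k. k) ` {1..level r s - 1})"
    by (rule sum_index_basis_vec) (use a le m in auto)
  moreover have "(\<Sum>j\<in>{1..level u s}. e a $ (n + j - 1)) = of_bool (a \<in> (+) n ` {1..level u s})"
    by (rule sum_index_basis_vec) (use a le m in auto)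
  ultimately show ?thesis
    unfolding scalar_prod_nu_i[OF basis_vec_carrier s] image_add_interval using a level_pos[of r s]
    by auto
qed

lemma e_nu:
  assumes a: "a \<in> {1..m}"
  shows "e a \<bullet> nu p u r = (if a \<le> n then 1 else - 1)"
proof -
  have "(\<Sum>k\<in>{1..n}. e a $ (k - 1)) = of_bool (a \<in> (\<lambda>k. k) ` {1..n})"
    by (rule sum_index_basis_vec) (use a m in auto)
  moreover have "(\<Sum>j\<in>{1..q}. e a $ (n + j - 1)) = of_bool (a \<in> (+) n ` {1..q})"
    by (rule sum_index_basis_vec) (use a m in auto)
  ultimately show ?thesis
    unfolding scalar_prod_nu[OF basis_vec_carrier] image_add_interval using a m by auto
qed

lemma e_e: "a \<in> {1..m} \<Longrightarrow> b \<in> {1..m} \<Longrightarrow> e a \<bullet> e b = of_bool (a = b)"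
  by (auto simp: scalar_prod_basis_vec index_basis_vec)

section \<open>The cone satisfies the inequalities\<close>

lemma G_carrier: "G \<subseteq> carrier_vec m"
  unfolding generator_exponents_def by auto

lemma cone_subset:
  "cone_of m G \<subseteq> (\<Inter>a\<in>normals p u r. halfspace m a) \<inter> hyperplane m (nu p u r)"
proof
  fix x assume x: "x \<in> cone_of m G"
  have gen: "(\<forall>a\<in>normals p u r. 0 \<le> g \<bullet> a) \<and> g \<bullet> nu p u r = 0" if gG: "g \<in> G" for g
  proof -
    obtain i j where g: "g = e i + e (n + j)" and V: "(i, j) \<in> V"
      using gG unfolding generator_exponents_def by blast
    have ij: "i \<in> {1..n}" "j \<in> {1..q}" "i < level r s \<Longrightarrow> s \<in> {1..p - 1} \<Longrightarrow> j \<le> level u s" for s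
      using V vertices_iff by auto
    have ij': "i \<in> {1..m}" "n + j \<in> {1..m}" using ij m by auto
    have dot: "g \<bullet> a = e i \<bullet> a + e (n + j) \<bullet> a" if "a \<in> carrier_vec m" for a
      unfolding g by (rule add_scalar_prod_distrib[of _ m]) (use that in auto)
    \<comment> \<open>A contribution -1 arises only if \<open>i < level r s\<close>; then
      \<open>j \<le> level u s\<close>, and \<open>e (n + j)\<close> contributes +1.\<close>
    have "0 \<le> g \<bullet> nu_i p u r s" if s: "s \<in> {1..p - 1}" for s
      using ij(1,2) ij(3)[of s] level_le_last[OF s] s by (auto simp: dot e_nu_i[OF ij'(1) s] e_nu_i[OF ij'(2) s])
    moreover have "0 \<le> g \<bullet> e k" if "k \<in> {1..m}" for k
      by (simp add: dot e_e[OF ij'(1) that] e_e[OF ij'(2) that])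
    moreover have "g \<bullet> nu p u r = 0"
      using ij by (auto simp: dot e_nu[OF ij'(1)] e_nu[OF ij'(2)])
    ultimately show ?thesis unfolding ball_normals by blast
  qed
  have "x \<in> carrier_vec m" "x \<bullet> nu p u r = 0"
    using cone_of_scalar_prod[OF x G_carrier nu_carrier] gen by auto
  moreover have "0 \<le> x \<bullet> a" if "a \<in> normals p u r" for a
    using cone_of_scalar_prod(2)[OF x G_carrier, of a] gen that normals_carrier by blast
  ultimately show "x \<in> (\<Inter>a\<in>normals p u r. halfspace m a) \<inter> hyperplane m (nu p u r)"
    by (auto simp: halfspace_def hyperplane_def)
qed

section \<open>The inequalities cut out the cone\<close>

text \<open>The first summand lives on positions up to \<open>n\<close>, the second beyond
  \<open>n\<close>, so each coordinate sees only one of them. This gives both injectivity in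
  \<open>(i, j)\<close> and the recovery of a point from the marginals of a plan.\<close>

lemma index_generator:
  assumes "i \<in> {1..n}" "j \<in> {1..q}"
  shows "t \<in> {1..n} \<Longrightarrow> (e i + e (n + j)) $ (t - 1) = of_bool (i = t)"
    and "t \<in> {1..q} \<Longrightarrow> (e i + e (n + j)) $ (n + t - 1) = of_bool (j = t)"
proof -
  have c: "(e i + e (n + j)) $ k = of_bool (i = Suc k) + of_bool (n + j = Suc k)" if "k < m" for k
  proof -
    have ij: "i \<in> {1..m}" "n + j \<in> {1..m}" using assms m by auto
    have "(e i + e (n + j)) $ k = e i $ k + e (n + j) $ k"
      by (rule index_add_vec) (use that in \<open>simp add: carrier_vecD[OF basis_vec_carrier]\<close>)
    then show ?thesis
      using index_basis_vec[OF ij(1) that] index_basis_vec[OF ij(2) that] by simp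
  qed
  show "(e i + e (n + j)) $ (t - 1) = of_bool (i = t)" if "t \<in> {1..n}"
    using c[of "t - 1"] that assms m by auto
  show "(e i + e (n + j)) $ (n + t - 1) = of_bool (j = t)" if "t \<in> {1..q}"
    using c[of "n + t - 1"] that assms m by auto
qed

lemma cone_supset:
  "(\<Inter>a\<in>normals p u r. halfspace m a) \<inter> hyperplane m (nu p u r) \<subseteq> cone_of m G"
proof
  fix x assume x: "x \<in> (\<Inter>a\<in>normals p u r. halfspace m a) \<inter> hyperplane m (nu p u r)"
  then have xm: "x \<in> carrier_vec m" and xnu: "x \<bullet> nu p u r = 0"
    and xa: "\<forall>a\<in>normals p u r. 0 \<le> x \<bullet> a"
    by (auto simp: halfspace_def hyperplane_def)
  have nonneg: "0 \<le> x $ (k - 1)" if "k \<in> {1..m}" for k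
    using xa[unfolded ball_normals] that by (metis scalar_prod_basis_vec)
  define f g where "f k = x $ (k - 1)" and "g j = x $ (n + j - 1)" for k j
  have f: "0 \<le> f k" if "k \<in> {1..n}" for k
    using nonneg[of k] that m by (auto simp: f_def)
  have g: "0 \<le> g j" if "j \<in> {1..q}" for j
    using nonneg[of "n + j"] that m by (auto simp: g_def)
  have total: "sum f {1..n} = sum g {1..q}"
    using xnu unfolding scalar_prod_nu[OF xm] f_def g_def by simp
  have off: "sum f {1..i} \<le> sum g {1..j - 1}"
    if ij: "i \<in> {1..n}" "j \<in> {1..q}" "(i, j) \<notin> V" for i j
  proof -
    obtain s where s: "s \<in> {1..p - 1}" "i < level r s" "level u s < j"
      using ij vertices_iff[of i j] by (metis not_le)
    note le = level_le_last[OF s(1)]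
    \<comment> \<open>Partial sums of nonnegative terms grow, so both ends can be moved to the
      cutoffs of \<open>\<nu>\<^sub>s\<close>, where its inequality applies.\<close>
    have "sum f {1..i} \<le> sum f {1..level r s - 1}"
      by (rule sum_mono2) (use s le f in auto)
    also have "\<dots> \<le> sum g {1..level u s}"
      using xa s(1) unfolding ball_normals by (auto simp: scalar_prod_nu_i[OF xm] f_def g_def)
    also have "\<dots> \<le> sum g {1..j - 1}"
      by (rule sum_mono2) (use s ij g in auto)
    finally show ?thesis .
  qed
  obtain C where C: "\<And>i j. i \<in> {1..n} \<Longrightarrow> j \<in> {1..q} \<Longrightarrow> 0 \<le> C i j"
    "\<And>i j. i \<in> {1..n} \<Longrightarrow> j \<in> {1..q} \<Longrightarrow> (i, j) \<notin> V \<Longrightarrow> C i j = 0"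
    and row: "\<And>i. i \<in> {1..n} \<Longrightarrow> (\<Sum>j\<in>{1..q}. C i j) = f i"
    and col: "\<And>j. j \<in> {1..q} \<Longrightarrow> (\<Sum>i\<in>{1..n}. C i j) = g j"
    using transport_plan[of n f q g V] f g total off by blast
  let ?g = "\<lambda>(i, j). e i + e (n + j)"
  have VD: "i \<in> {1..n} \<and> j \<in> {1..q}" if "(i, j) \<in> V" for i j
    using that vertices_iff by auto
  show "x \<in> cone_of m G"
  proof (rule cone_ofI[where V = V and g = ?g and C = "\<lambda>(i, j). C i j"])
    show "finite V" by (rule finite_V)
    show "G \<subseteq> carrier_vec m" by (rule G_carrier)
    show "x \<in> carrier_vec m" by (rule xm)
    show "?g ` V \<subseteq> G" unfolding generator_exponents_def by auto
    show "0 \<le> (case v of (i, j) \<Rightarrow> C i j)" if "v \<in> V" for v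
      using that VD C(1) by (cases v) auto
    show "inj_on ?g V"
    proof (rule inj_onI, clarify)
      fix i j k l assume V: "(i, j) \<in> V" "(k, l) \<in> V" and eq: "e i + e (n + j) = e k + e (n + l)"
      note ij = VD[OF V(1)] and kl = VD[OF V(2)]
      \<comment> \<open>Position \<open>i\<close> carries 1 on the left, hence also on the right,
        which forces \<open>k = i\<close>; position \<open>n + j\<close> does the same for
        \<open>l\<close>.\<close>
      have "(of_bool (i = i) :: real) = of_bool (k = i)"
        using index_generator(1)[of i j i] index_generator(1)[of k l i] ij kl eq by metis
      moreover have "(of_bool (j = j) :: real) = of_bool (l = j)"
        using index_generator(2)[of i j j] index_generator(2)[of k l j] ij kl eq by metis
      ultimately show "i = k \<and> j = l" by auto
    qed
    fix t assume t: "t < m"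
    let ?h = "\<lambda>i j. C i j * (e i + e (n + j)) $ t"
    have "(\<Sum>v\<in>V. (case v of (i, j) \<Rightarrow> C i j) * ?g v $ t) = (\<Sum>(i, j)\<in>V. ?h i j)"
      by (rule sum.cong) auto
    \<comment> \<open>The plan vanishes off \<open>V\<close>, so the sum may run over the whole
      rectangle.\<close>
    also have "\<dots> = (\<Sum>(i, j)\<in>{1..n} \<times> {1..q}. ?h i j)"
      by (rule sum.mono_neutral_left) (use VD C in auto)
    also have "\<dots> = (\<Sum>i\<in>{1..n}. \<Sum>j\<in>{1..q}. ?h i j)"
      by (rule sum.cartesian_product[symmetric])
    \<comment> \<open>An \<open>x\<close>-coordinate selects a single \<open>i\<close> and leaves
      the sum over \<open>j\<close>, a \<open>y\<close>-coordinate the reverse; both marginals of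
      the plan are known.\<close>
    also have "\<dots> = x $ t"
    proof (cases "t < n")
      case True
      then have t1: "Suc t \<in> {1..n}" by auto
      have "(\<Sum>i\<in>{1..n}. \<Sum>j\<in>{1..q}. ?h i j) = (\<Sum>i\<in>{1..n}. \<Sum>j\<in>{1..q}. if i = Suc t then C i j else 0)"
        by (intro sum.cong refl) (use index_generator(1)[OF _ _ t1] in simp)
      also have "\<dots> = (\<Sum>i\<in>{1..n}. if i = Suc t then \<Sum>j\<in>{1..q}. C i j else 0)"
        by (intro sum.cong refl) simp
      also have "\<dots> = f (Suc t)" using t1 row[OF t1] by simp
      finally show ?thesis by (simp add: f_def)
    next
      case False
      define j where "j = Suc (t - n)"
      have j: "j \<in> {1..q}" "t = n + j - 1" using False t m by (auto simp: j_def)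
      have "(\<Sum>i\<in>{1..n}. \<Sum>l\<in>{1..q}. ?h i l) = (\<Sum>i\<in>{1..n}. \<Sum>l\<in>{1..q}. if l = j then C i l else 0)"
        by (intro sum.cong refl) (use index_generator(2)[OF _ _ j(1)] j(2) in simp)
      also have "\<dots> = (\<Sum>i\<in>{1..n}. C i j)"
        using j(1) by simp
      also have "\<dots> = g j" by (rule col[OF j(1)])
      finally show ?thesis by (simp add: g_def j(2))
    qed
    finally show "x $ t = (\<Sum>v\<in>V. (case v of (i, j) \<Rightarrow> C i j) * ?g v $ t)" by simp
  qed
qed

section \<open>Irredundancy\<close>

text \<open>The witness is \<open>e l - e k\<close>. Its pairing with \<open>nu\<close> cancels
  because both indices lie in the same group, and \<open>e k\<close> is the only basis vector with
  which it pairs negatively.\<close>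

lemma violating_difference:
  assumes k: "k \<in> {1..m}" and l: "l \<in> {1..m}" and kl: "l \<noteq> k" "l \<le> n \<longleftrightarrow> k \<le> n"
    and nu: "\<And>s. s \<in> {1..p - 1} \<Longrightarrow> e k \<bullet> nu_i p u r s \<le> e l \<bullet> nu_i p u r s"
  shows "\<exists>x\<in>hyperplane m (nu p u r). x \<bullet> e k < 0 \<and> (\<forall>a\<in>normals p u r - {e k}. 0 \<le> x \<bullet> a)"
proof
  have dot: "(e l - e k) \<bullet> a = e l \<bullet> a - e k \<bullet> a" if "a \<in> carrier_vec m" for a
    by (rule minus_scalar_prod_distrib[of _ m]) (use that in auto)
  show "e l - e k \<in> hyperplane m (nu p u r)"
    using kl by (simp add: hyperplane_def dot e_nu[OF k] e_nu[OF l])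
  have "\<forall>a\<in>normals p u r. a \<noteq> e k \<longrightarrow> 0 \<le> (e l - e k) \<bullet> a"
    unfolding ball_normals using nu by (auto simp: dot e_e[OF k] e_e[OF l])
  then show "(e l - e k) \<bullet> e k < 0 \<and> (\<forall>a\<in>normals p u r - {e k}. 0 \<le> (e l - e k) \<bullet> a)"
    using kl by (simp add: dot e_e[OF k k] e_e[OF l k])
qed

lemma violating_point:
  assumes "b \<in> normals p u r"
  shows "\<exists>x\<in>hyperplane m (nu p u r). x \<bullet> b < 0 \<and> (\<forall>a\<in>normals p u r - {b}. 0 \<le> x \<bullet> a)"
proof -
  have n2: "2 \<le> n" using level_r_less[of 0 p] p by (simp add: level_0)
  consider s where "s \<in> {1..p - 1}" "b = nu_i p u r s" | k where "k \<in> {1..m}" "b = e k"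
    using assms unfolding normals_def by blast
  then show ?thesis
  proof cases
    case (1 s)
    \<comment> \<open>The last column and the lowest row excluded by the condition for
      \<open>s\<close>.\<close>
    let ?i = "level r s - 1" and ?j = "level u s + 1"
    have s: "0 < s" "s < p" using 1 by auto
    have ij: "?i \<in> {1..n}" "?j \<in> {1..q}"
      using level_r_less[of 0 s] level_r_less[of s p] level_u_less[of s p] s
      by (auto simp: level_0)
    have ij': "?i \<in> {1..m}" "n + ?j \<in> {1..m}" using ij m by auto
    let ?x = "e ?i + e (n + ?j)"
    have dot: "?x \<bullet> a = e ?i \<bullet> a + e (n + ?j) \<bullet> a" if "a \<in> carrier_vec m" for a
      by (rule add_scalar_prod_distrib[of _ m]) (use that in auto)
    have nu_t: "?x \<bullet> nu_i p u r t = of_bool (?j \<le> level u t) - of_bool (?i < level r t)"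
      if t: "t \<in> {1..p - 1}" for t
      using ij level_le_last[OF t]
      unfolding dot[OF nu_i_carrier] e_nu_i[OF ij'(1) t] e_nu_i[OF ij'(2) t] by auto
    have "?x \<in> hyperplane m (nu p u r)"
      using ij by (auto simp: hyperplane_def dot[OF nu_carrier] e_nu[OF ij'(1)] e_nu[OF ij'(2)]
          simp del: add_Suc_right One_nat_def)
    moreover have "?x \<bullet> b < 0"
      using ij unfolding 1(2) nu_t[OF 1(1)] by auto
    moreover have "\<forall>a\<in>normals p u r. a \<noteq> b \<longrightarrow> 0 \<le> ?x \<bullet> a"
      unfolding ball_normals
    proof (intro conjI ballI impI)
      fix t assume t: "t \<in> {1..p - 1}" "nu_i p u r t \<noteq> b"
      \<comment> \<open>For \<open>t < s\<close> column \<open>?i\<close> is no longer left of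
        \<open>level r t\<close>, so the negative term vanishes; for \<open>s < t\<close> row
        \<open>?j\<close> is at most \<open>level u t\<close>, so the positive term is 1.\<close>
      then have "t < s \<or> s < t" using 1 by fastforce
      moreover have "t \<le> p" using t(1) by auto
      ultimately show "0 \<le> ?x \<bullet> nu_i p u r t"
        using level_r_less[of t s] level_u_less[of s t] s t unfolding nu_t[OF t(1)] by auto
    next
      fix k assume k: "k \<in> {1..m}"
      show "0 \<le> ?x \<bullet> e k"
        unfolding dot[OF basis_vec_carrier] e_e[OF ij'(1) k] e_e[OF ij'(2) k] by simp
    qed
    ultimately show ?thesis by blast
  next
    case (2 k)
    consider "k < n" | "k = n" | "k = n + 1" | "n + 1 < k" by linarith
    then show ?thesis
    proof cases
      case a: 1
      \<comment> \<open>One column to the right: \<open>k + 1 < level r s\<close> implies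
        \<open>k < level r s\<close>, so an entry -1 at \<open>l\<close> is also present at
        \<open>k\<close>.\<close>
      have l: "k + 1 \<in> {1..m}" using a m by auto
      show ?thesis unfolding 2(2)
        by (rule violating_difference[OF 2(1) l]) (use a 2 l in \<open>auto simp: e_nu_i\<close>)
    next
      case a: 2
      \<comment> \<open>The last two columns have the same height.\<close>
      have l: "n - 1 \<in> {1..m}" using n2 m by auto
      have "\<not> n - 1 < level r s" if "s \<in> {1..p - 1}" for s
      proof -
        have "s < p" using that by auto
        then show ?thesis using level_r_less[of s p] by simp
      qed
      then show ?thesis unfolding 2(2)
        by (intro violating_difference[OF 2(1) l]) (use a 2 l n2 in \<open>auto simp: e_nu_i\<close>)
    next
      case a: 3
      \<comment> \<open>The rows 1 and 2 meet the same columns.\<close>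
      have u2: "2 \<le> level u s" if "0 < s" "s \<le> p" for s
        using level_u_less[of 0 s] that by (simp add: level_0)
      have l: "n + 2 \<in> {1..m}" using u2[of p] p m by auto
      show ?thesis unfolding 2(2)
        by (rule violating_difference[OF 2(1) l]) (use a 2 l u2 in \<open>auto simp: e_nu_i\<close>)
    next
      case a: 4
      \<comment> \<open>Row 1 has the largest possible entry, +1, in every
        \<open>\<nu>\<^sub>s\<close>.\<close>
      have l: "n + 1 \<in> {1..m}" using level_pos[of u p] m by auto
      have "\<not> n + 1 < level r s" if "s \<in> {1..p - 1}" for s
        using level_le_last[OF that] by simp
      then show ?thesis unfolding 2(2)
        by (intro violating_difference[OF 2(1) l]) (use a 2 l level_pos in \<open>auto simp: e_nu_i\<close>)
    qed
  qed
qed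

text \<open>A point violating only the inequality of \<open>b\<close> survives when that inequality
  is dropped, yet lies outside the cone by the first inclusion.\<close>

lemma irredundant:
  assumes "b \<in> normals p u r"
  shows "cone_of m G \<noteq> (\<Inter>a\<in>normals p u r - {b}. halfspace m a) \<inter> hyperplane m (nu p u r)"
proof -
  obtain x where x: "x \<in> hyperplane m (nu p u r)" "x \<bullet> b < 0" "\<forall>a\<in>normals p u r - {b}. 0 \<le> x \<bullet> a"
    using violating_point[OF assms] by blast
  have "x \<in> (\<Inter>a\<in>normals p u r - {b}. halfspace m a) \<inter> hyperplane m (nu p u r)"
    using x by (auto simp: halfspace_def hyperplane_def)
  moreover have "x \<notin> cone_of m G"
  proof
    assume "x \<in> cone_of m G"
    then have "x \<in> halfspace m b" using cone_subset assms by blast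
    then show False using x(2) by (simp add: halfspace_def)
  qed
  ultimately show ?thesis by blast
qed

end

theorem lemma7:
  fixes p :: nat and u r :: "nat \<Rightarrow> nat"
  assumes "1 \<le> p"
    and "\<forall>i\<in>{1..p}. 0 < u i \<and> 0 < r i"
  shows "cone_of (ambient_dim p u r) (generator_exponents p u r) =
      (\<Inter>a\<in>normals p u r. halfspace (ambient_dim p u r) a)
        \<inter> hyperplane (ambient_dim p u r) (nu p u r) \<and>
    (\<forall>b\<in>normals p u r.
      cone_of (ambient_dim p u r) (generator_exponents p u r) \<noteq>
        (\<Inter>a\<in>normals p u r - {b}. halfspace (ambient_dim p u r) a)
          \<inter> hyperplane (ambient_dim p u r) (nu p u r))"
proof -
  interpret staircase_data p u r
    by unfold_locales (use assms in auto)
  show ?thesis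
    using cone_subset cone_supset irredundant by blast
qed

end
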